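(* Let $\widehat V:\mathcal A\to L^0(\mathcal F;\mathbb R^n\cup\{-\infty\})$ be an upper-semicontinuous ($\mathbb R^n$-valued) market model satisfying the no-arbitrage condition. Then the set of superhedgeable claims $$\mathcal C=\{h\in L^0(\mathcal F;\mathbb R^n):\exists\,\vartheta\in\mathcal A \text{ with } \widehat V(\vartheta)\succeq_K h\ \text{a.s.}\}$$ is closed in probability.
   Context: $(\Omega,\mathcal F,\mathbb P)$ is a probability space with a filtration $(\mathcal F_t)_{t=0,\dots,T}$, $\mathcal F_t\subseteq\mathcal F$. The set of strategies is $\mathcal A=\{(\vartheta_0,\dots,\vartheta_{T-1}) : \vartheta_t\in L^0(\Omega,\mathcal F_t,\mathbb P;\mathbb R^d)\ \forall t\}$, identified a.s. and regarded as $\mathbb R^{dT}$-valued random vectors. An $\mathbb R^n$-valued market model is a mapping $\widehat V:\mathcal A\to L^0(\mathcal F;\mathbb R^n\cup\{-\infty\})$, where $-\infty$ is a single point appended to $\mathbb R^n$, such that (A1) $\widehat V(0)=0$ a.s.; (A2) for all $t$, $A\in\mathcal F_t$, $\vartheta\in\mathcal A$: $\widehat V(\vartheta)$ and $\widehat V(\vartheta_0,\dots,\vartheta_{t-1},\vartheta_t\mathbf 1_A,\vartheta_{t+1},\dots,\vartheta_{T-1})$ coincide a.s. on $A$. $K:\Omega\rightrightarrows\mathbb R^n$ is a fixed $\mathcal F$ measurable set-valued map whose values are closed convex cones with $\operatorname{int}K(\omega)\ne\varnothing$ for almost all $\omega$. For $a,b\in\mathbb R^n$, $a\succeq_{K(\omega)}b$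 iff $a-b\in K(\omega)$; $a\succeq_{K(\omega)}-\infty$ always, and $-\infty\succeq_{K(\omega)}a$ fails for $a\in\mathbb R^n$. For random vectors $X\succeq_KY$ means $X(\omega)\succeq_{K(\omega)}Y(\omega)$ a.s. The positive polar is $K^\circ(\omega)=\{y\in\mathbb R^n:\langle x,y\rangle\ge0\ \forall x\in K(\omega)\}$; $L^0(\mathcal F;\operatorname{ri}K^\circ)$ is the set of $\mathcal F$ measurable selections of its relative interior; $\langle Z,-\infty\rangle:=-\infty$. $\widehat V$ is upper-semicontinuous if for every $Z\in L^0(\mathcal F;\operatorname{ri}K^\circ)$ the map $\widehat V_Z(\vartheta)=\langle Z,\widehat V(\vartheta)\rangle$ satisfies $\limsup_n\widehat V_Z(\vartheta_n)\le\widehat V_Z(\vartheta)$ a.s. whenever $\vartheta_n\in\mathcal A\cap L^\infty$ converges in $L^\infty$ to $\vartheta\in\mathcal A$. For each such $Z$, $V_Z:\Omega\times\mathbb R^{dT}\to\mathbb R\cup\{-\infty\}$ denotes a (fixed) $\mathcal F$ normal integrand representing $\widehat V_Z$, i.e. $\omega\mapsto\{(x,r):r\le V_Z(\omega,x)\}$ is closed-valued and $\mathcal F$ measurable and $\widehat V_Z(\vartheta)(\omega)=V_Z(\omega,\vartheta(\omega))$ a.s. for all $\vartheta\in\mathcal A$. Put $V_Z^\infty(\omega,z)=\lim_{\lambda\to\infty}\sup_{\delta>\lambda,\,|x-z|<1/\lambda}\frac1\delta V_Z(\omega,\delta x)$ and $V_Z^\infty(\vartheta)(\omega)=V_Z^\infty(\omega,\vartheta(\omega))$.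 No-arbitrage condition: $\{\vartheta\in\mathcal A: V_Z^\infty(\vartheta)\ge0\text{ a.s. for all }Z\in L^0(\mathcal F;\operatorname{ri}K^\circ)\}=\{0\}$. *)

theory Defs
  imports "HOL-Probability.Probability"
begin

text \<open>
  Conventions.
  The trading dates \<open>0, \<dots>, T - 1\<close> are the elements of a finite linearly ordered type \<open>'t\<close>,
  so \<open>T = CARD('t) \<ge> 1\<close>, and the date of \<open>t :: 't\<close> is its position in the order.
  Strategy vectors live in \<open>real ^ 'd ^ 't\<close>, whose norm is the Euclidean norm
  of \<open>R\<^sup>d\<^sup>T\<close>.
  Elements of \<open>L\<^sup>0\<close> are represented by functions; every condition on them holds almost surely,
  and a market model is required to respect almost sure equality.
  The space \<open>R\<^sup>n\<close> with one extra point is \<open>(real ^ 'n) option\<close>, with \<open>None\<close> the point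
  minus infinity.
\<close>

definition date :: "'t::{finite,linorder} \<Rightarrow> nat" where
  "date t = card {s. s < t}"

definition finite_filtration :: "'a measure \<Rightarrow> nat \<Rightarrow> (nat \<Rightarrow> 'a measure) \<Rightarrow> bool" where
  "finite_filtration M T F \<longleftrightarrow>
     (\<forall>k\<le>T. subalgebra M (F k)) \<and> (\<forall>j k. j \<le> k \<and> k \<le> T \<longrightarrow> sets (F j) \<subseteq> sets (F k))"

definition strategies ::
    "(nat \<Rightarrow> 'a measure) \<Rightarrow> ('a \<Rightarrow> real ^ 'd ^ 't::{finite,linorder}) set" where
  "strategies F = {\<theta>. \<forall>t. (\<lambda>\<omega>. \<theta> \<omega> $ t) \<in> borel_measurable (F (date t))}"

definition localize_at ::
    "'t \<Rightarrow> 'a set \<Rightarrow> ('a \<Rightarrow> real ^ 'd ^ 't) \<Rightarrow> ('a \<Rightarrow> real ^ 'd ^ 't)" where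
  "localize_at t A \<theta> = (\<lambda>\<omega>. \<chi> s. if s = t then indicator A \<omega> *\<^sub>R (\<theta> \<omega> $ s) else \<theta> \<omega> $ s)"

text \<open>Measurability for the sum of the Borel space \<open>R\<^sup>n\<close> and a point.  Taking \<open>B = UNIV\<close>
  covers the event that the value is minus infinity.\<close>

definition ext_random_vector :: "'a measure \<Rightarrow> ('a \<Rightarrow> (real ^ 'n) option) \<Rightarrow> bool" where
  "ext_random_vector M X \<longleftrightarrow> (\<forall>B\<in>sets borel. {\<omega>\<in>space M. X \<omega> \<in> Some ` B} \<in> sets M)"

definition market_model ::
    "'a measure \<Rightarrow> (nat \<Rightarrow> 'a measure) \<Rightarrow>
     (('a \<Rightarrow> real ^ 'd ^ 't::{finite,linorder}) \<Rightarrow> 'a \<Rightarrow> (real ^ 'n) option) \<Rightarrow> bool" where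
  "market_model M F Vh \<longleftrightarrow>
     (\<forall>\<theta>\<in>strategies F. ext_random_vector M (Vh \<theta>)) \<and>
     (\<forall>\<theta>\<in>strategies F. \<forall>\<theta>'\<in>strategies F.
        (AE \<omega> in M. \<theta> \<omega> = \<theta>' \<omega>) \<longrightarrow> (AE \<omega> in M. Vh \<theta> \<omega> = Vh \<theta>' \<omega>)) \<and>
     (AE \<omega> in M. Vh (\<lambda>_. 0) \<omega> = Some 0) \<and>
     (\<forall>t. \<forall>A\<in>sets (F (date t)). \<forall>\<theta>\<in>strategies F.
        AE \<omega> in M. \<omega> \<in> A \<longrightarrow> Vh \<theta> \<omega> = Vh (localize_at t A \<theta>) \<omega>)"

definition measurable_set_map :: "'a measure \<Rightarrow> ('a \<Rightarrow> 'b::topological_space set) \<Rightarrow> bool" where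
  "measurable_set_map M S \<longleftrightarrow> (\<forall>U. open U \<longrightarrow> {\<omega>\<in>space M. S \<omega> \<inter> U \<noteq> {}} \<in> sets M)"

definition solvency_cone_map :: "'a measure \<Rightarrow> ('a \<Rightarrow> (real ^ 'n) set) \<Rightarrow> bool" where
  "solvency_cone_map M K \<longleftrightarrow>
     measurable_set_map M K \<and>
     (\<forall>\<omega>\<in>space M. closed (K \<omega>) \<and> convex_cone (K \<omega>)) \<and>
     (AE \<omega> in M. interior (K \<omega>) \<noteq> {})"

fun cone_ge :: "(real ^ 'n) set \<Rightarrow> (real ^ 'n) option \<Rightarrow> (real ^ 'n) option \<Rightarrow> bool" where
  "cone_ge C a None = True"
| "cone_ge C None (Some b) = False"
| "cone_ge C (Some a) (Some b) = (a - b \<in> C)"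

definition positive_polar :: "(real ^ 'n) set \<Rightarrow> (real ^ 'n) set" where
  "positive_polar C = {y. \<forall>x\<in>C. x \<bullet> y \<ge> 0}"

definition polar_selections ::
    "'a measure \<Rightarrow> ('a \<Rightarrow> (real ^ 'n) set) \<Rightarrow> ('a \<Rightarrow> real ^ 'n) set" where
  "polar_selections M K =
     {Z \<in> borel_measurable M. AE \<omega> in M. Z \<omega> \<in> rel_interior (positive_polar (K \<omega>))}"

fun ext_inner :: "real ^ 'n \<Rightarrow> (real ^ 'n) option \<Rightarrow> ereal" where
  "ext_inner z None = -\<infinity>"
| "ext_inner z (Some v) = ereal (z \<bullet> v)"

definition Linfty :: "'a measure \<Rightarrow> ('a \<Rightarrow> 'b::euclidean_space) set" where
  "Linfty M = {f \<in> borel_measurable M. esssup M (\<lambda>\<omega>. ereal (norm (f \<omega>))) < \<infinity>}"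

definition usc_market ::
    "'a measure \<Rightarrow> (nat \<Rightarrow> 'a measure) \<Rightarrow> ('a \<Rightarrow> (real ^ 'n) set) \<Rightarrow>
     (('a \<Rightarrow> real ^ 'd ^ 't::{finite,linorder}) \<Rightarrow> 'a \<Rightarrow> (real ^ 'n) option) \<Rightarrow> bool" where
  "usc_market M F K Vh \<longleftrightarrow>
     (\<forall>Z\<in>polar_selections M K. \<forall>\<theta>s. \<forall>\<theta>\<in>strategies F.
        (\<forall>k. \<theta>s k \<in> strategies F \<inter> Linfty M) \<and>
        (\<lambda>k. esssup M (\<lambda>\<omega>. ereal (norm (\<theta>s k \<omega> - \<theta> \<omega>)))) \<longlonglongrightarrow> 0 \<longrightarrow>
        (AE \<omega> in M. limsup (\<lambda>k. ext_inner (Z \<omega>) (Vh (\<theta>s k) \<omega>)) \<le> ext_inner (Z \<omega>) (Vh \<theta> \<omega>)))"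

definition normal_integrand :: "'a measure \<Rightarrow> ('a \<Rightarrow> 'b::euclidean_space \<Rightarrow> ereal) \<Rightarrow> bool" where
  "normal_integrand M f \<longleftrightarrow>
     (\<forall>\<omega>\<in>space M. \<forall>x. f \<omega> x \<noteq> \<infinity>) \<and>
     (\<forall>\<omega>\<in>space M. closed {(x, r::real). ereal r \<le> f \<omega> x}) \<and>
     measurable_set_map M (\<lambda>\<omega>. {(x, r::real). ereal r \<le> f \<omega> x})"

definition represents ::
    "'a measure \<Rightarrow> (nat \<Rightarrow> 'a measure) \<Rightarrow>
     ('a \<Rightarrow> real ^ 'd ^ 't::{finite,linorder} \<Rightarrow> ereal) \<Rightarrow>
     (('a \<Rightarrow> real ^ 'd ^ 't::{finite,linorder}) \<Rightarrow> 'a \<Rightarrow> ereal) \<Rightarrow> bool" where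
  "represents M F f G \<longleftrightarrow>
     normal_integrand M f \<and> (\<forall>\<theta>\<in>strategies F. AE \<omega> in M. G \<theta> \<omega> = f \<omega> (\<theta> \<omega>))"

definition horizon :: "('b::euclidean_space \<Rightarrow> ereal) \<Rightarrow> 'b \<Rightarrow> ereal" where
  "horizon f z =
     Lim at_top (\<lambda>l::real. SUP (\<delta>, x)\<in>{(\<delta>, x). \<delta> > l \<and> norm (x - z) < 1 / l}.
                    ereal (1 / \<delta>) * f (\<delta> *\<^sub>R x))"

text \<open>\<open>V Z\<close> is the fixed normal integrand representing the scalarization by \<open>Z\<close>.\<close>

definition no_arbitrage ::
    "'a measure \<Rightarrow> (nat \<Rightarrow> 'a measure) \<Rightarrow> ('a \<Rightarrow> (real ^ 'n) set) \<Rightarrow>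
     (('a \<Rightarrow> real ^ 'n) \<Rightarrow> 'a \<Rightarrow> real ^ 'd ^ 't::{finite,linorder} \<Rightarrow> ereal) \<Rightarrow> bool" where
  "no_arbitrage M F K V \<longleftrightarrow>
     (\<forall>\<theta>\<in>strategies F.
        (\<forall>Z\<in>polar_selections M K. AE \<omega> in M. horizon (V Z \<omega>) (\<theta> \<omega>) \<ge> 0) \<longleftrightarrow>
        (AE \<omega> in M. \<theta> \<omega> = 0))"

definition superhedgeable ::
    "'a measure \<Rightarrow> (nat \<Rightarrow> 'a measure) \<Rightarrow> ('a \<Rightarrow> (real ^ 'n) set) \<Rightarrow>
     (('a \<Rightarrow> real ^ 'd ^ 't::{finite,linorder}) \<Rightarrow> 'a \<Rightarrow> (real ^ 'n) option) \<Rightarrow>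
     ('a \<Rightarrow> real ^ 'n) set" where
  "superhedgeable M F K Vh =
     {h \<in> borel_measurable M.
        \<exists>\<theta>\<in>strategies F. AE \<omega> in M. cone_ge (K \<omega>) (Vh \<theta> \<omega>) (Some (h \<omega>))}"

definition tendsto_in_probability ::
    "'a measure \<Rightarrow> (nat \<Rightarrow> 'a \<Rightarrow> 'b::euclidean_space) \<Rightarrow> ('a \<Rightarrow> 'b) \<Rightarrow> bool" where
  "tendsto_in_probability M X Y \<longleftrightarrow>
     (\<forall>\<epsilon>>0. (\<lambda>k. measure M {\<omega>\<in>space M. norm (X k \<omega> - Y \<omega>) > \<epsilon>}) \<longlonglongrightarrow> 0)"

text \<open>Convergence in probability is metrizable on \<open>L\<^sup>0\<close>, so closedness is sequential.\<close>

definition closed_in_probability :: "'a measure \<Rightarrow> ('a \<Rightarrow> 'b::euclidean_space) set \<Rightarrow> bool" where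
  "closed_in_probability M C \<longleftrightarrow>
     (\<forall>X. \<forall>Y\<in>borel_measurable M.
        (\<forall>k. X k \<in> C) \<and> tendsto_in_probability M X Y \<longrightarrow> Y \<in> C)"

end

theory Submission
  imports Defs
begin

text \<open>
  Along a subsequence the claims converge almost surely; let \<open>\<theta> k\<close> be the hedging strategies.
  If they are almost surely bounded, cluster points of the dates can be chosen successively and
  measurably, which gives an adapted pointwise cluster point \<open>\<eta>\<close>.  It inherits the scalarized
  inequalities because the hypographs of \<open>V Z\<close> are closed, and countably many \<open>Z\<close> suffice
  to recover the order of \<open>K\<close>.
  Boundedness is shown by backward induction over the dates: if the sequence is bounded before
  date \<open>n\<close> but not at date \<open>n\<close>, divide it by the norm of its component at date \<open>n\<close>.  By the
  induction hypothesis the quotient is bounded, so it has an adapted cluster point, whose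
  components before date \<open>n\<close> vanish and whose component at date \<open>n\<close> has norm one.
  All its horizon functions are nonnegative, against the no-arbitrage condition.
  No concavity is involved.
\<close>

section \<open>Measurable and adapted cluster points\<close>

text \<open>The limit inferior of \<open>x\<close> along the indices at which \<open>d\<close> is small: a cluster point of \<open>x\<close>
  realized jointly with the cluster value \<open>0\<close> of \<open>d\<close>, hence without extracting a random
  subsequence.\<close>

definition cluster_near :: "(nat \<Rightarrow> real) \<Rightarrow> (nat \<Rightarrow> real) \<Rightarrow> real" where
  "cluster_near d x =
     real_of_ereal (SUP j. liminf (\<lambda>k. if d k < inverse (real (Suc j)) then ereal (x k) else \<infinity>))"

lemma cluster_near_measurable:
  assumes [measurable]: "\<And>k. (\<lambda>\<omega>. d \<omega> k) \<in> borel_measurable N" "\<And>k. (\<lambda>\<omega>. x \<omega> k) \<in> borel_measurable N"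
  shows "(\<lambda>\<omega>. cluster_near (d \<omega>) (x \<omega>)) \<in> borel_measurable N"
  unfolding cluster_near_def by measurable

text \<open>Tightening the threshold on \<open>d\<close> only raises the limit inferior. A fine
  enough threshold therefore gives values eventually above the cluster value minus \<open>e\<close>,
  while a limit inferior not above the cluster value forces values below it plus \<open>e\<close>
  infinitely often. Such finite values occur only where \<open>d\<close> is small.\<close>

lemma frequently_cluster_near:
  assumes d: "\<And>e. e > 0 \<Longrightarrow> \<exists>\<^sub>F k in sequentially. d k < e"
    and bounded: "bounded (range x)" and e: "e > 0"
  shows "\<exists>\<^sub>F k in sequentially. d k < e \<and> \<bar>x k - cluster_near d x\<bar> < e"
proof -
  obtain b where b: "\<And>k. \<bar>x k\<bar> \<le> b"
    using bounded unfolding bounded_iff by auto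
  define z where "z j k = (if d k < inverse (real (Suc j)) then ereal (x k) else \<infinity>)" for j k
  define L where "L j = liminf (z j)" for j
  have ge: "ereal (- b) \<le> L j" for j
    unfolding L_def by (rule Liminf_bounded) (use b in \<open>auto simp: z_def abs_le_iff minus_le_iff\<close>)
  \<comment> \<open>Here the frequent smallness of \<open>d\<close> enters: without it the default
    value \<infinity> could prevail and the supremum would be infinite.\<close>
  have le: "L j \<le> ereal b" for j
  proof (rule ccontr)
    assume "\<not> ?thesis"
    then have "\<forall>\<^sub>F k in sequentially. ereal b < z j k"
      unfolding L_def by (intro less_LiminfD) auto
    moreover have "\<exists>\<^sub>F k in sequentially. d k < inverse (real (Suc j))" by (rule d) simp
    ultimately have "\<exists>\<^sub>F k in sequentially. d k < inverse (real (Suc j)) \<and> ereal b < z j k"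
      by (rule frequently_eventually_frequently[rotated])
    then have "\<exists>\<^sub>F k in sequentially. b < x k"
      by (rule frequently_elim1) (simp add: z_def split: if_splits)
    then have "\<exists>\<^sub>F k in sequentially. False"
      by (rule frequently_elim1) (use b in \<open>meson abs_le_D1 not_less\<close>)
    then show False by simp
  qed
  have "ereal (- b) \<le> (SUP j. L j)" "(SUP j. L j) \<le> ereal b"
    using ge le by (auto intro: SUP_upper2 SUP_least)
  then obtain l where l: "(SUP j. L j) = ereal l" by (cases "SUP j. L j") auto
  then have cl: "cluster_near d x = l" unfolding cluster_near_def L_def z_def by simp
  have mono: "L i \<le> L j" if "i \<le> j" for i j
  proof -
    have "inverse (real (Suc j)) \<le> inverse (real (Suc i))" using that by simp
    then have "d k < inverse (real (Suc i))" if "d k < inverse (real (Suc j))" for k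
      using that by linarith
    then have "z i k \<le> z j k" for k unfolding z_def by (auto simp del: of_nat_Suc)
    then show ?thesis
      unfolding L_def by (intro Liminf_mono always_eventually allI)
  qed
  obtain i where i: "ereal (l - e) < L i"
    using l e less_SUP_iff[of "ereal (l - e)" L UNIV] by auto
  obtain j0 where j0: "inverse (real (Suc j0)) < e" using reals_Archimedean[OF e] by blast
  \<comment> \<open>From \<open>i\<close> on the limit inferior exceeds \<open>l - e\<close>; from
    \<open>j0\<close> on the threshold is below \<open>e\<close>.\<close>
  define j where "j = max i j0"
  have j: "ereal (l - e) < L j" using i mono[of i j] by (auto simp: j_def)
  have "inverse (real (Suc j)) \<le> inverse (real (Suc j0))" by (simp add: j_def)
  then have j': "inverse (real (Suc j)) < e" using j0 by (rule le_less_trans)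
  have "L j \<le> ereal l" using l by (metis SUP_upper UNIV_I)
  then have "\<exists>\<^sub>F k in sequentially. z j k < ereal (l + e)"
  proof -
    have "\<not> (\<forall>\<^sub>F k in sequentially. ereal (l + e) \<le> z j k)"
    proof
      assume "\<forall>\<^sub>F k in sequentially. ereal (l + e) \<le> z j k"
      then have "ereal (l + e) \<le> L j" unfolding L_def by (rule Liminf_bounded)
      from order_trans[OF this \<open>L j \<le> ereal l\<close>] have "ereal (l + e) \<le> ereal l" .
      then show False using e by simp
    qed
    then show ?thesis by (simp add: not_eventually not_le)
  qed
  moreover have "\<forall>\<^sub>F k in sequentially. ereal (l - e) < z j k"
    using j unfolding L_def by (rule less_LiminfD)
  ultimately have "\<exists>\<^sub>F k in sequentially. z j k < ereal (l + e) \<and> ereal (l - e) < z j k"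
    by (rule frequently_eventually_frequently)
  then show ?thesis
    by (rule frequently_elim1) (use j' in \<open>auto simp: cl z_def split: if_splits\<close>)
qed

text \<open>The coordinates are chosen one after another. The errors of those already chosen are
  merged into the control sequence \<open>d\<close>, so that all coordinates cluster along common
  indices.\<close>

lemma measurable_cluster_vector:
  fixes x :: "'a \<Rightarrow> nat \<Rightarrow> 'b::euclidean_space"
  assumes d: "\<And>k. (\<lambda>\<omega>. d \<omega> k) \<in> borel_measurable N" and x: "\<And>k. (\<lambda>\<omega>. x \<omega> k) \<in> borel_measurable N"
  obtains y where "y \<in> borel_measurable N"
    "\<And>\<omega> e. \<lbrakk>\<And>e. e > 0 \<Longrightarrow> \<exists>\<^sub>F k in sequentially. d \<omega> k < e; bounded (range (x \<omega>)); e > 0\<rbrakk>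
       \<Longrightarrow> \<exists>\<^sub>F k in sequentially. d \<omega> k < e \<and> norm (x \<omega> k - y \<omega>) < e"
proof -
  let ?near = "\<lambda>\<omega> k B c. \<Sum>b\<in>B. \<bar>x \<omega> k \<bullet> b - c b \<omega>\<bar>"
  let ?ok = "\<lambda>\<omega>. (\<forall>e>0. \<exists>\<^sub>F k in sequentially. d \<omega> k < e) \<and> bounded (range (x \<omega>))"
  have "\<exists>c. (\<forall>b\<in>B. c b \<in> borel_measurable N) \<and> (\<forall>\<omega>. ?ok \<omega> \<longrightarrow>
      (\<forall>e>0. \<exists>\<^sub>F k in sequentially. max (d \<omega> k) (?near \<omega> k B c) < e))" if "finite B" for B
    using that
  proof (induction B)
    case empty
    then show ?case by auto
  next
    case (insert a B)
    then obtain c where c: "\<And>b. b \<in> B \<Longrightarrow> c b \<in> borel_measurable N"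
      and fr: "\<And>\<omega> e. ?ok \<omega> \<Longrightarrow> e > 0 \<Longrightarrow> \<exists>\<^sub>F k in sequentially. max (d \<omega> k) (?near \<omega> k B c) < e"
      by blast
    define ca where "ca \<omega> = cluster_near (\<lambda>k. max (d \<omega> k) (?near \<omega> k B c)) (\<lambda>k. x \<omega> k \<bullet> a)" for \<omega>
    have ca: "ca \<in> borel_measurable N"
      unfolding ca_def using d x c
      by (intro cluster_near_measurable borel_measurable_max borel_measurable_sum borel_measurable_abs
          borel_measurable_diff borel_measurable_inner borel_measurable_const)
    have "\<exists>\<^sub>F k in sequentially. max (d \<omega> k) (?near \<omega> k (insert a B) (c(a := ca))) < e"
      if ok: "?ok \<omega>" and "e > 0" for \<omega> e
    proof -
      have "bounded (range (\<lambda>k. x \<omega> k \<bullet> a))"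
        using bounded_linear_image[OF _ bounded_linear_inner_left, of "range (x \<omega>)" a] ok by (simp add: image_image)
      then have "\<exists>\<^sub>F k in sequentially. max (d \<omega> k) (?near \<omega> k B c) < e / 2 \<and> \<bar>x \<omega> k \<bullet> a - ca \<omega>\<bar> < e / 2"
        unfolding ca_def using fr[OF ok] \<open>e > 0\<close> by (intro frequently_cluster_near) auto
      moreover have "?near \<omega> k (insert a B) (c(a := ca)) = \<bar>x \<omega> k \<bullet> a - ca \<omega>\<bar> + ?near \<omega> k B c" for k
      proof -
        have "?near \<omega> k B (c(a := ca)) = ?near \<omega> k B c"
          using insert.hyps by (intro sum.cong) auto
        then show ?thesis using insert.hyps by simp
      qed
      ultimately show ?thesis
        using \<open>e > 0\<close> by (elim frequently_elim1) (auto simp: max_def simp del: fun_upd_apply split: if_splits)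
    qed
    then show ?case using c ca by (intro exI[of _ "c(a := ca)"]) auto
  qed
  from this[OF finite_Basis] obtain c where c: "\<And>b. b \<in> Basis \<Longrightarrow> c b \<in> borel_measurable N"
    and fr: "\<And>\<omega> e. ?ok \<omega> \<Longrightarrow> e > 0 \<Longrightarrow> \<exists>\<^sub>F k in sequentially. max (d \<omega> k) (?near \<omega> k Basis c) < e"
    by blast
  define y where "y \<omega> = (\<Sum>b\<in>Basis. c b \<omega> *\<^sub>R b)" for \<omega>
  have le: "norm (x \<omega> k - y \<omega>) \<le> ?near \<omega> k Basis c" for \<omega> k
    using norm_le_l1[of "x \<omega> k - y \<omega>"] by (simp add: y_def inner_diff_left cong: sum.cong)
  have "y \<in> borel_measurable N" unfolding y_def using c by measurable
  then show ?thesis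
  proof (intro that[of y])
    fix \<omega> and e :: real
    assume "\<And>e. e > 0 \<Longrightarrow> \<exists>\<^sub>F k in sequentially. d \<omega> k < e" "bounded (range (x \<omega>))" "e > 0"
    then have "\<exists>\<^sub>F k in sequentially. max (d \<omega> k) (?near \<omega> k Basis c) < e" by (intro fr) auto
    then show "\<exists>\<^sub>F k in sequentially. d \<omega> k < e \<and> norm (x \<omega> k - y \<omega>) < e"
      by (rule frequently_elim1) (auto intro: le_less_trans[OF le])
  qed
qed

section \<open>Dates and adapted cluster points\<close>

lemma date_less: "s < t \<Longrightarrow> date s < date t"
  unfolding date_def by (intro psubset_card_mono) auto

lemma date_eq_iff: "date s = date t \<longleftrightarrow> s = t"
  by (metis date_less less_irrefl linorder_neqE)

lemma date_less_CARD: "date (t::'t::{finite,linorder}) < CARD('t)"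
  unfolding date_def by (intro psubset_card_mono) auto

lemma borel_measurable_filtration_mono:
  fixes s t :: "'t::{finite,linorder}"
  assumes filt: "finite_filtration M CARD('t) F" and "s \<le> t" "f \<in> borel_measurable (F (date s))"
  shows "f \<in> borel_measurable (F (date t))"
proof (rule measurable_from_subalg[OF _ assms(3)])
  have "date s \<le> date t" using assms(2) date_less[of s t] by (cases "s = t") (auto simp: le_less)
  then show "subalgebra (F (date t)) (F (date s))"
    using filt date_less_CARD[of t] unfolding finite_filtration_def subalgebra_def by auto
qed

text \<open>The choice at each date is controlled only by the components in \<open>S\<close> at
  earlier dates, so it uses only information available then. Allowing a proper subset
  \<open>S\<close> serves the normalization argument, where the components at the earliest dates
  tend to zero.\<close>

lemma adapted_cluster:
  fixes x :: "nat \<Rightarrow> 'a \<Rightarrow> real ^ 'd ^ 't::{finite,linorder}"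
  assumes filt: "finite_filtration M CARD('t) F"
    and x: "\<And>k s. s \<in> S \<Longrightarrow> (\<lambda>\<omega>. x k \<omega> $ s) \<in> borel_measurable (F (date s))"
  obtains y where "y \<in> strategies F" "\<And>\<omega> s. s \<notin> S \<Longrightarrow> y \<omega> $ s = 0"
    "\<And>\<omega> e. \<lbrakk>\<And>s. s \<in> S \<Longrightarrow> bounded (range (\<lambda>k. x k \<omega> $ s)); e > 0\<rbrakk>
       \<Longrightarrow> \<exists>\<^sub>F k in sequentially. \<forall>s\<in>S. norm (x k \<omega> $ s - y \<omega> $ s) < e"
proof -
  have "finite S" by simp
  then have "\<exists>y. (\<forall>s\<in>S. y s \<in> borel_measurable (F (date s))) \<and>
     (\<forall>\<omega> e. (\<forall>s\<in>S. bounded (range (\<lambda>k. x k \<omega> $ s))) \<and> e > 0 \<longrightarrow>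
        (\<exists>\<^sub>F k in sequentially. (\<Sum>s\<in>S. norm (x k \<omega> $ s - y s \<omega>)) < e))"
    using x
  \<comment> \<open>Each step adds a date later than all previous ones, which makes the control
    sequence measurable at the new date.\<close>
  proof (induction S rule: finite_linorder_max_induct)
    case empty
    then show ?case by auto
  next
    case (insert t S)
    let ?d = "\<lambda>y \<omega> k. \<Sum>s\<in>S. norm (x k \<omega> $ s - y s \<omega>)"
    from insert obtain y where y: "\<And>s. s \<in> S \<Longrightarrow> y s \<in> borel_measurable (F (date s))"
      and fr: "\<And>\<omega> e. \<lbrakk>\<forall>s\<in>S. bounded (range (\<lambda>k. x k \<omega> $ s)); e > 0\<rbrakk> \<Longrightarrow>
        \<exists>\<^sub>F k in sequentially. ?d y \<omega> k < e"
      by force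
    have "(\<lambda>\<omega>. x k \<omega> $ s) \<in> borel_measurable (F (date t))" "y s \<in> borel_measurable (F (date t))"
      if "s \<in> S" for k s
      using that insert.hyps insert.prems[of s] y[of s] by (auto intro!: borel_measurable_filtration_mono[OF filt, of s t] less_imp_le)
    then have "(\<lambda>\<omega>. ?d y \<omega> k) \<in> borel_measurable (F (date t))" for k
      by (intro borel_measurable_sum measurable_compose[OF _ borel_measurable_norm] borel_measurable_diff)
    then obtain z where z: "z \<in> borel_measurable (F (date t))"
      "\<And>\<omega> e. \<lbrakk>\<And>e. e > 0 \<Longrightarrow> \<exists>\<^sub>F k in sequentially. ?d y \<omega> k < e; bounded (range (\<lambda>k. x k \<omega> $ t)); e > 0\<rbrakk>
       \<Longrightarrow> \<exists>\<^sub>F k in sequentially. ?d y \<omega> k < e \<and> norm (x k \<omega> $ t - z \<omega>) < e"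
      using insert.prems[of t]
      by (rule measurable_cluster_vector[where x="\<lambda>\<omega> k. x k \<omega> $ t" and d="?d y"]) blast+
    have t: "t \<notin> S" using insert by auto
    have "\<exists>\<^sub>F k in sequentially. (\<Sum>s\<in>insert t S. norm (x k \<omega> $ s - (y(t := z)) s \<omega>)) < e"
      if "\<forall>s\<in>insert t S. bounded (range (\<lambda>k. x k \<omega> $ s))" "e > 0" for \<omega> e
    proof -
      have "\<exists>\<^sub>F k in sequentially. ?d y \<omega> k < e / 2 \<and> norm (x k \<omega> $ t - z \<omega>) < e / 2"
        using that by (intro z(2) fr) auto
      moreover have "?d (y(t := z)) \<omega> k = ?d y \<omega> k" for k
        using t by (intro sum.cong) auto
      ultimately show ?thesis
        using t by (auto elim!: frequently_elim1)
    qed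
    then show ?case using y z(1) t by (intro exI[of _ "y(t := z)"]) auto
  qed
  then obtain y where y: "\<And>s. s \<in> S \<Longrightarrow> y s \<in> borel_measurable (F (date s))"
    and fr: "\<And>\<omega> e. \<lbrakk>\<And>s. s \<in> S \<Longrightarrow> bounded (range (\<lambda>k. x k \<omega> $ s)); e > 0\<rbrakk> \<Longrightarrow>
        \<exists>\<^sub>F k in sequentially. (\<Sum>s\<in>S. norm (x k \<omega> $ s - y s \<omega>)) < e"
    by blast
  show ?thesis
  proof (rule that[of "\<lambda>\<omega>. \<chi> s. if s \<in> S then y s \<omega> else 0"])
    show "(\<lambda>\<omega>. \<chi> s. if s \<in> S then y s \<omega> else 0) \<in> strategies F"
      unfolding strategies_def
    proof (intro CollectI allI)
      show "(\<lambda>\<omega>. (\<chi> s. if s \<in> S then y s \<omega> else 0) $ t) \<in> borel_measurable (F (date t))" for t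
        using y[of t] by (cases "t \<in> S") simp_all
    qed
    fix \<omega> and e :: real
    assume *: "\<And>s. s \<in> S \<Longrightarrow> bounded (range (\<lambda>k. x k \<omega> $ s))" "e > 0"
    show "\<exists>\<^sub>F k in sequentially. \<forall>s\<in>S. norm (x k \<omega> $ s - (\<chi> s. if s \<in> S then y s \<omega> else 0) $ s) < e"
      using fr[OF *]
    proof (rule frequently_elim1)
      fix k assume "(\<Sum>s\<in>S. norm (x k \<omega> $ s - y s \<omega>)) < e"
      then show "\<forall>s\<in>S. norm (x k \<omega> $ s - (\<chi> s. if s \<in> S then y s \<omega> else 0) $ s) < e"
        using member_le_sum[of _ S "\<lambda>s. norm (x k \<omega> $ s - y s \<omega>)"] by (auto intro: le_less_trans)
    qed
  qed simp
qed

text \<open>Frequent closeness on \<open>S\<close> and eventual closeness off \<open>S\<close>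
  combine to frequent closeness of the whole vector. The subsequence is extracted at a fixed
  outcome, after the limit has been chosen measurably, and may vary with the outcome.\<close>

lemma vec_cluster_subseq:
  fixes a :: "nat \<Rightarrow> ('b::real_normed_vector) ^ 't"
  assumes S: "\<And>e. e > 0 \<Longrightarrow> \<exists>\<^sub>F k in sequentially. \<forall>s\<in>S. norm (a k $ s - y $ s) < e"
    and notS: "\<And>s. s \<notin> S \<Longrightarrow> (\<lambda>k. a k $ s) \<longlonglongrightarrow> y $ s"
  obtains r :: "nat \<Rightarrow> nat" where "strict_mono r" "(\<lambda>j. a (r j)) \<longlonglongrightarrow> y"
proof -
  have "\<exists>\<^sub>F k in sequentially. \<forall>s. norm (a k $ s - y $ s) < e" if "e > 0" for e
  proof -
    have "\<forall>\<^sub>F k in sequentially. \<forall>s\<in>-S. norm (a k $ s - y $ s) < e"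
    proof (rule eventually_ball_finite)
      show "\<forall>s\<in>-S. \<forall>\<^sub>F k in sequentially. norm (a k $ s - y $ s) < e"
        using tendstoD[OF notS that] by (auto simp: dist_norm)
    qed simp
    from frequently_eventually_frequently[OF S[OF that] this] show ?thesis
      by (rule frequently_elim1) auto
  qed
  note near = this
  have "\<exists>k>n. \<forall>s. norm (a k $ s - y $ s) < inverse (real (Suc j))" for n j
  proof -
    have "0 < inverse (real (Suc j))" by simp
    from frequently_eventually_frequently[OF near[OF this] eventually_gt_at_top[of n]] show ?thesis
      by (auto dest!: frequently_ex)
  qed
  then have "\<exists>r. \<forall>j. (\<forall>s. norm (a (r j) $ s - y $ s) < inverse (real (Suc j))) \<and> r j < r (Suc j)"
    by (intro dependent_nat_choice) blast+
  then obtain r where r: "\<And>j s. norm (a (r j) $ s - y $ s) < inverse (real (Suc j))"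
    and mono: "\<And>j. r j < r (Suc j)" by blast
  have "(\<lambda>j. a (r j) $ s - y $ s) \<longlonglongrightarrow> 0" for s
    by (rule Lim_null_comparison[OF always_eventually LIMSEQ_inverse_real_of_nat])
      (use r in \<open>auto intro: less_imp_le\<close>)
  then have "(\<lambda>j. a (r j)) \<longlonglongrightarrow> y" by (intro vec_tendstoI) (simp add: Lim_null[symmetric])
  then show ?thesis using that[of r] mono by (simp add: strict_mono_Suc_iff)
qed

section \<open>Horizon functions and convergence in probability\<close>

text \<open>For each fixed \<open>l\<close> the pairs \<open>\<delta> = 1 / a k\<close>,
  \<open>x = a k *\<^sub>R y k\<close> eventually compete in the supremum, and their values are at
  least \<open>a k * (- c)\<close>, which tends to 0.\<close>

lemma horizon_nonneg:
  fixes f :: "'b::euclidean_space \<Rightarrow> ereal"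
  assumes a: "a \<longlonglongrightarrow> 0" "\<And>k. a k > 0" and x: "(\<lambda>k. a k *\<^sub>R y k) \<longlonglongrightarrow> z"
    and f: "\<And>k. ereal (- c) \<le> f (y k)"
  shows "horizon f z \<ge> 0"
proof -
  define A where "A l = {(\<delta>, x). \<delta> > l \<and> norm (x - z) < 1 / l}" for l :: real
  define \<phi> where "\<phi> l = (SUP (\<delta>, x)\<in>A l. ereal (1 / \<delta>) * f (\<delta> *\<^sub>R x))" for l
  have anti: "\<phi> l' \<le> \<phi> l" if "0 < l" "l \<le> l'" for l l'
  proof -
    have "1 / l' \<le> 1 / l" using that by (simp add: frac_le)
    then show ?thesis unfolding \<phi>_def using that by (intro SUP_subset_mono) (auto simp: A_def)
  qed
  have nonneg: "0 \<le> \<phi> l" if "l > 0" for l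
  proof (rule tendsto_upperbound)
    show "(\<lambda>k. ereal (a k * (- c))) \<longlonglongrightarrow> 0"
      using tendsto_mult_left[OF a(1), of "-c"] by (auto simp: zero_ereal_def mult.commute)
    have "\<forall>\<^sub>F k in sequentially. a k < 1 / l"
      using that order_tendstoD(2)[OF a(1)] by simp
    moreover have "\<forall>\<^sub>F k in sequentially. dist (a k *\<^sub>R y k) z < 1 / l"
      using that tendstoD[OF x] by simp
    ultimately show "\<forall>\<^sub>F k in sequentially. ereal (a k * (- c)) \<le> \<phi> l"
    proof eventually_elim
      case (elim k)
      have "(1 / a k, a k *\<^sub>R y k) \<in> A l"
        using elim a(2)[of k] that by (auto simp: A_def dist_norm field_simps)
      then have "ereal (1 / (1 / a k)) * f ((1 / a k) *\<^sub>R (a k *\<^sub>R y k)) \<le> \<phi> l"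
        unfolding \<phi>_def by (rule SUP_upper2) simp
      moreover have "ereal (a k * (- c)) \<le> ereal (a k) * f (y k)"
        using ereal_mult_left_mono[OF f[of k], of "ereal (a k)"] a(2)[of k] by simp
      moreover have "a k \<noteq> 0" using a(2)[of k] by simp
      ultimately show ?case by simp
    qed
  qed simp
  \<comment> \<open>The value of \<open>Lim\<close> is known only once a limit is exhibited. Since
    \<phi> is antitone on the positive reals, its limit is the infimum over them.\<close>
  have "(\<phi> \<longlongrightarrow> (INF l\<in>{0<..}. \<phi> l)) at_top"
  proof (rule order_tendstoI)
    fix u assume u: "u < (INF l\<in>{0<..}. \<phi> l)"
    have "u < \<phi> l" if "l > 0" for l
      using u INF_lower[of l "{0<..}" \<phi>] that by (auto intro: less_le_trans)
    then show "\<forall>\<^sub>F l in at_top. u < \<phi> l"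
      using eventually_gt_at_top[of "0::real"] by (rule eventually_mono[rotated])
  next
    fix u assume "(INF l\<in>{0<..}. \<phi> l) < u"
    then obtain l where "l > 0" "\<phi> l < u" by (auto simp: INF_less_iff)
    then have "\<phi> l' < u" if "l' \<ge> l" for l'
      using anti[of l l'] that by (auto intro: le_less_trans)
    then show "\<forall>\<^sub>F l in at_top. \<phi> l < u"
      using eventually_ge_at_top[of l] by (rule eventually_mono[rotated])
  qed
  then have "horizon f z = (INF l\<in>{0<..}. \<phi> l)"
    unfolding horizon_def \<phi>_def A_def by (intro tendsto_Lim) auto
  then show ?thesis using nonneg by (auto intro: INF_greatest)
qed

text \<open>Borel-Cantelli: \<open>(1 / 2) ^ j\<close> serves both as the tolerance and as the bound
  on the probability of exceeding it, so the probabilities are summable while the tolerances tend to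
  zero.\<close>

lemma AE_subseq_of_tendsto_in_probability:
  fixes X :: "nat \<Rightarrow> 'a \<Rightarrow> 'b::euclidean_space"
  assumes "prob_space M" and lim: "tendsto_in_probability M X Y"
    and [measurable]: "\<And>k. X k \<in> borel_measurable M" "Y \<in> borel_measurable M"
  obtains r :: "nat \<Rightarrow> nat" where "strict_mono r" "AE \<omega> in M. (\<lambda>k. X (r k) \<omega>) \<longlonglongrightarrow> Y \<omega>"
proof -
  interpret prob_space M by fact
  let ?A = "\<lambda>j k. {\<omega>\<in>space M. norm (X k \<omega> - Y \<omega>) > (1 / 2) ^ j}"
  have "\<exists>k>n. measure M (?A j k) < (1 / 2) ^ j" for j n
  proof -
    have "(\<lambda>k. measure M (?A j k)) \<longlonglongrightarrow> 0" using lim unfolding tendsto_in_probability_def by simp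
    then have "\<forall>\<^sub>F k in sequentially. measure M (?A j k) < (1 / 2) ^ j"
      by (rule order_tendstoD) simp
    then have "\<forall>\<^sub>F k in sequentially. measure M (?A j k) < (1 / 2) ^ j \<and> k > n"
      using eventually_gt_at_top by (rule eventually_conj)
    then show ?thesis using eventually_happens'[OF sequentially_bot] by blast
  qed
  then have "\<exists>r. \<forall>j. measure M (?A j (r j)) < (1 / 2) ^ j \<and> r j < r (Suc j)"
    by (intro dependent_nat_choice) blast+
  then obtain r where r: "\<And>j. measure M (?A j (r j)) < (1 / 2) ^ j" "\<And>j. r j < r (Suc j)" by blast
  have "summable (\<lambda>j. measure M (?A j (r j)))"
    by (rule summable_comparison_test'[of "\<lambda>j. (1 / 2) ^ j"]) (use r(1) in \<open>auto simp: less_imp_le\<close>)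
  then have "AE \<omega> in M. \<forall>\<^sub>F j in sequentially. \<omega> \<in> space M - ?A j (r j)"
    by (intro borel_cantelli_AE1) (auto simp: emeasure_eq_measure)
  then have "AE \<omega> in M. (\<lambda>k. X (r k) \<omega>) \<longlonglongrightarrow> Y \<omega>"
  proof (rule AE_mp, intro AE_I2 impI)
    fix \<omega> assume "\<forall>\<^sub>F j in sequentially. \<omega> \<in> space M - ?A j (r j)"
    then have "\<forall>\<^sub>F j in sequentially. norm (X (r j) \<omega> - Y \<omega>) \<le> (1 / 2) ^ j"
      by (auto elim!: eventually_mono)
    then have "(\<lambda>j. X (r j) \<omega> - Y \<omega>) \<longlonglongrightarrow> 0"
      by (rule Lim_null_comparison) (rule LIMSEQ_power_zero, simp)
    then show "(\<lambda>k. X (r k) \<omega>) \<longlonglongrightarrow> Y \<omega>" by (simp add: Lim_null[symmetric])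
  qed
  then show ?thesis using that[of r] r(2) by (simp add: strict_mono_Suc_iff)
qed

section \<open>Measurable selections of the polar cone\<close>

lemma measurable_infdist_set_map:
  fixes K :: "'a \<Rightarrow> 'b::metric_space set"
  assumes "measurable_set_map M K" and "\<And>\<omega>. \<omega> \<in> space M \<Longrightarrow> K \<omega> \<noteq> {}"
  shows "(\<lambda>\<omega>. infdist x (K \<omega>)) \<in> borel_measurable M"
proof (rule borel_measurableI_less)
  fix r
  have "infdist x (K \<omega>) < r \<longleftrightarrow> K \<omega> \<inter> ball x r \<noteq> {}" if "\<omega> \<in> space M" for \<omega>
  proof -
    have "infdist x (K \<omega>) < r \<longleftrightarrow> (\<exists>y\<in>K \<omega>. dist x y < r)"
      using assms(2)[OF that] by (simp add: infdist_def cINF_less_iff)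
    then show ?thesis by auto
  qed
  then have "{\<omega>\<in>space M. infdist x (K \<omega>) < r} = {\<omega>\<in>space M. K \<omega> \<inter> ball x r \<noteq> {}}" by auto
  then show "{\<omega>\<in>space M. infdist x (K \<omega>) < r} \<in> sets M"
    using assms(1) by (simp add: measurable_set_map_def)
qed

lemma infdist_eq_dist_closest_point:
  assumes "closed S" "S \<noteq> {}"
  shows "infdist x S = dist x (closest_point S x)"
  using setdist_closest_point[OF assms, of x] by (simp add: infdist_eq_setdist)

text \<open>The gradient of the squared distance to \<open>S\<close> is \<open>2 (x - closest_point S x)\<close>; this
  makes the projection onto a measurable convex set measurable.\<close>

lemma infdist_sqr_diff_quotient:
  fixes S :: "'b::euclidean_space set"
  assumes "convex S" "closed S" "S \<noteq> {}"
  shows "\<bar>(infdist (x + h) S)\<^sup>2 - (infdist x S)\<^sup>2 - 2 * (h \<bullet> (x - closest_point S x))\<bar> \<le> 3 * (norm h)\<^sup>2"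
proof -
  let ?p = "closest_point S x" and ?q = "closest_point S (x + h)"
  \<comment> \<open>Each projection is a competitor for the other point, which bounds the increment
    on both sides, with gradients at \<open>?p\<close> and at \<open>?q\<close>. Since the
    projection is nonexpansive, exchanging \<open>?q\<close> for \<open>?p\<close> costs only a
    multiple of \<open>(norm h)\<^sup>2\<close>; the constant 3 is generous.\<close>
  have le: "dist x ?p \<le> dist x ?q" "dist (x + h) ?q \<le> dist (x + h) ?p"
    using assms by (auto intro!: closest_point_le closest_point_in_set)
  have lip: "norm (?p - ?q) \<le> norm h"
    using closest_point_lipschitz[OF assms, of x "x + h"] by (simp add: dist_norm)
  have "\<bar>h \<bullet> (?p - ?q)\<bar> \<le> norm h * norm (?p - ?q)" by (rule Cauchy_Schwarz_ineq2)
  also have "\<dots> \<le> (norm h)\<^sup>2" using lip by (simp add: power2_eq_square mult_left_mono)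
  finally have cs: "\<bar>h \<bullet> (?p - ?q)\<bar> \<le> (norm h)\<^sup>2" .
  have 1: "(norm (x + h - ?q))\<^sup>2 \<le> (norm (x + h - ?p))\<^sup>2"
    using le(2) by (simp add: dist_norm power_mono)
  have 2: "(norm (x - ?p))\<^sup>2 \<le> (norm (x - ?q))\<^sup>2"
    using le(1) by (simp add: dist_norm power_mono)
  have e: "(norm (x + h - v))\<^sup>2 = (norm (x - v))\<^sup>2 + 2 * (h \<bullet> (x - v)) + (norm h)\<^sup>2" for v
    by (simp add: power2_norm_eq_inner inner_simps inner_commute)
  have "h \<bullet> (x - ?q) = h \<bullet> (x - ?p) + h \<bullet> (?p - ?q)" by (simp add: inner_simps)
  then show ?thesis
    using 1 2 cs unfolding infdist_eq_dist_closest_point[OF assms(2,3)] dist_norm e abs_le_iff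
    by linarith
qed

lemma measurable_closest_point:
  fixes K :: "'a \<Rightarrow> 'b::euclidean_space set"
  assumes "measurable_set_map M K"
    and K: "\<And>\<omega>. \<omega> \<in> space M \<Longrightarrow> convex (K \<omega>) \<and> closed (K \<omega>) \<and> K \<omega> \<noteq> {}"
  shows "(\<lambda>\<omega>. closest_point (K \<omega>) x) \<in> borel_measurable M"
proof (subst borel_measurable_euclidean_space, intro ballI)
  fix b :: 'b assume b: "b \<in> Basis"
  have [measurable]: "(\<lambda>\<omega>. infdist z (K \<omega>)) \<in> borel_measurable M" for z
    using K by (intro measurable_infdist_set_map[OF assms(1)]) blast
  \<comment> \<open>This is \<open>x \<bullet> b\<close> minus half the difference quotient of the
    squared distance along \<open>b\<close> with step 1 / (k + 1); its error is at most 3 / 2 times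
    the step.\<close>
  define g where "g k \<omega> = x \<bullet> b - real (Suc k) / 2 *
    ((infdist (x + inverse (real (Suc k)) *\<^sub>R b) (K \<omega>))\<^sup>2 - (infdist x (K \<omega>))\<^sup>2)" for k \<omega>
  show "(\<lambda>\<omega>. closest_point (K \<omega>) x \<bullet> b) \<in> borel_measurable M"
  proof (rule borel_measurable_LIMSEQ_real)
    show "g k \<in> borel_measurable M" for k unfolding g_def by measurable
    fix \<omega> assume \<omega>: "\<omega> \<in> space M"
    have le: "norm (g k \<omega> - closest_point (K \<omega>) x \<bullet> b) \<le> 3 / 2 * inverse (real (Suc k))" for k
    proof -
      define n where "n = real (Suc k)"
      have n: "n > 0" by (simp add: n_def)
      define D where "D = (infdist (x + inverse n *\<^sub>R b) (K \<omega>))\<^sup>2 - (infdist x (K \<omega>))\<^sup>2"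
      have "\<bar>D - 2 * ((inverse n *\<^sub>R b) \<bullet> (x - closest_point (K \<omega>) x))\<bar> \<le> 3 * (norm (inverse n *\<^sub>R b))\<^sup>2"
        unfolding D_def using K[OF \<omega>] by (intro infdist_sqr_diff_quotient) blast+
      then have D: "\<bar>D - 2 / n * (b \<bullet> (x - closest_point (K \<omega>) x))\<bar> \<le> 3 / n\<^sup>2"
        using b by (simp add: power_divide divide_inverse power_inverse mult.assoc)
      define a where "a = b \<bullet> (x - closest_point (K \<omega>) x)"
      have "n / 2 * \<bar>D - 2 / n * a\<bar> \<le> n / 2 * (3 / n\<^sup>2)"
        using n D unfolding a_def by (intro mult_left_mono) auto
      moreover have "n / 2 * \<bar>D - 2 / n * a\<bar> = \<bar>n / 2 * D - a\<bar>"
      proof -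
        have "\<bar>n / 2 * D - a\<bar> = \<bar>n / 2 * (D - 2 / n * a)\<bar>" using n by (simp add: right_diff_distrib)
        also have "\<dots> = n / 2 * \<bar>D - 2 / n * a\<bar>" using n by (simp add: abs_mult)
        finally show ?thesis by simp
      qed
      moreover have "n / 2 * (3 / n\<^sup>2) = 3 / 2 * inverse n"
        using n by (simp add: power2_eq_square inverse_eq_divide)
      moreover have "g k \<omega> - closest_point (K \<omega>) x \<bullet> b = - (n / 2 * D - a)"
        unfolding g_def D_def n_def a_def by (simp add: inner_diff_right inner_commute)
      ultimately show ?thesis
        unfolding n_def[symmetric] real_norm_def by (metis abs_minus_cancel)
    qed
    have lim: "(\<lambda>k. 3 / 2 * inverse (real (Suc k))) \<longlonglongrightarrow> 0"
      by (rule tendsto_mult_right_zero[OF LIMSEQ_inverse_real_of_nat])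
    have "(\<lambda>k. g k \<omega> - closest_point (K \<omega>) x \<bullet> b) \<longlonglongrightarrow> 0"
      using le by (intro Lim_null_comparison[OF always_eventually lim] allI)
    then show "(\<lambda>k. g k \<omega>) \<longlonglongrightarrow> closest_point (K \<omega>) x \<bullet> b" by (rule LIM_zero_cancel)
  qed
qed

section \<open>Projection onto a convex cone\<close>

lemma closest_point_convex_cone:
  fixes C :: "(real ^ 'n) set"
  assumes C: "closed C" "convex_cone C"
  shows closest_point_diff_in_polar: "closest_point C x - x \<in> positive_polar C"
    and closest_point_orthogonal: "(x - closest_point C x) \<bullet> closest_point C x = 0"
proof -
  let ?p = "closest_point C x"
  have ne: "C \<noteq> {}" and cv: "convex C" using C(2) by (auto simp: convex_cone_def)
  have p: "?p \<in> C" using C(1) ne by (rule closest_point_in_set)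
  have dot: "(x - ?p) \<bullet> (y - ?p) \<le> 0" if "y \<in> C" for y
    by (rule closest_point_dot[OF cv C(1) that])
  \<comment> \<open>Testing the variational inequality on both sides of \<open>?p\<close> along its
    ray, at 0 and at twice \<open>?p\<close>, gives both signs and hence orthogonality.\<close>
  have mem: "0 \<in> C" "?p + ?p \<in> C"
    using C(2) convex_cone_add[OF C(2) p p] unfolding convex_cone_iff by blast+
  show 0: "(x - ?p) \<bullet> ?p = 0"
    using dot[OF mem(1)] dot[OF mem(2)] by (simp add: inner_simps)
  show "?p - x \<in> positive_polar C"
    unfolding positive_polar_def
  proof (intro CollectI ballI)
    fix y assume "y \<in> C"
    from dot[OF this] 0 show "0 \<le> y \<bullet> (?p - x)" by (simp add: inner_simps inner_commute)
  qed
qed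

text \<open>By orthogonality the squared norm of the projection is minus its inner product with
  \<open>z\<close>, hence nonpositive. Consequently every polar vector \<open>z\<close> is the value
  of \<open>closest_point C x - x\<close> at \<open>x = - z\<close>: this map is onto the
  polar.\<close>

lemma closest_point_uminus_polar:
  fixes C :: "(real ^ 'n) set"
  assumes C: "closed C" "convex_cone C" and z: "z \<in> positive_polar C"
  shows "closest_point C (- z) = 0"
proof -
  let ?p = "closest_point C (- z)"
  have "?p \<in> C" using C by (auto intro!: closest_point_in_set simp: convex_cone_def)
  then have "0 \<le> ?p \<bullet> z" using z by (simp add: positive_polar_def)
  moreover have "(- z - ?p) \<bullet> ?p = 0" by (rule closest_point_orthogonal[OF C])
  ultimately have "?p \<bullet> ?p \<le> 0" by (simp add: inner_simps inner_commute)
  then show ?thesis by (metis inner_gt_zero_iff not_less)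
qed

section \<open>The positive polar and relative interiors of convex cones\<close>

lemma convex_cone_positive_polar: "convex_cone (positive_polar C)"
  by (auto simp: convex_cone_iff positive_polar_def inner_simps)

lemma closed_positive_polar: "closed (positive_polar C)"
proof -
  have "positive_polar C = (\<Inter>x\<in>C. {y. 0 \<le> x \<bullet> y})" by (auto simp: positive_polar_def)
  then show ?thesis by (auto intro!: closed_INT closed_halfspace_ge simp: closed_halfspace_ge)
qed

text \<open>Otherwise some functional is nonnegative on \<open>C\<close>, zero at the point by
  scaling, and positive on the relative interior; but then it is positive at \<open>c\<close> and
  nonnegative at \<open>x\<close>, hence positive at the point. This lets a small perturbation push
  any polar selection into the relative interior.\<close>

lemma rel_interior_add_convex_cone:
  fixes C :: "'b::euclidean_space set"
  assumes C: "convex_cone C" and c: "c \<in> rel_interior C" and x: "x \<in> C" and e: "e > 0"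
  shows "x + e *\<^sub>R c \<in> rel_interior C"
proof (rule ccontr)
  assume "\<not> ?thesis"
  moreover have "x + e *\<^sub>R c \<in> C"
    using C c x e rel_interior_subset[of C] by (auto simp: convex_cone_iff subset_iff)
  moreover have "convex C" using C by (simp add: convex_cone_def)
  ultimately obtain a where a: "\<And>y. y \<in> C \<Longrightarrow> a \<bullet> (x + e *\<^sub>R c) \<le> a \<bullet> y"
      "\<And>y. y \<in> rel_interior C \<Longrightarrow> a \<bullet> (x + e *\<^sub>R c) < a \<bullet> y"
    using supporting_hyperplane_rel_boundary by metis
  have mem: "x + (2 * e) *\<^sub>R c \<in> C" "x + 0 *\<^sub>R c \<in> C"  "2 *\<^sub>R (x + e *\<^sub>R c) \<in> C" "0 \<in> C" "c \<in> C"
    using C c x e rel_interior_subset[of C] by (auto simp: convex_cone_iff subset_iff)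
  have 0: "a \<bullet> (x + e *\<^sub>R c) = 0" using a(1)[OF mem(3)] a(1)[OF mem(4)] by (simp add: inner_simps)
  have "a \<bullet> (x + e *\<^sub>R c) < a \<bullet> c" by (rule a(2)[OF c])
  moreover have "0 \<le> a \<bullet> x" using a(1)[OF x] 0 by simp
  moreover have "0 < e * (a \<bullet> c)" using calculation(1) 0 e by simp
  ultimately show False using 0 by (simp add: inner_simps)
qed

text \<open>A supporting functional at the sum vanishes there and is nonnegative on
  \<open>C\<close>, so it vanishes at every term. The spanning condition \<open>dense\<close> then
  makes it vanish on \<open>C\<close>, although it is positive on the relative interior.\<close>

lemma suminf_in_rel_interior:
  fixes C :: "'b::euclidean_space set" and z :: "nat \<Rightarrow> 'b"
  assumes C: "convex_cone C" "closed C" and z: "\<And>i. z i \<in> C" "summable z"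
    and dense: "\<And>a. (\<And>i. a \<bullet> z i = 0) \<Longrightarrow> (\<And>y. y \<in> C \<Longrightarrow> a \<bullet> y = 0)"
  shows "suminf z \<in> rel_interior C"
proof (rule ccontr)
  assume notin: "suminf z \<notin> rel_interior C"
  have "sum z {..<n} \<in> C" for n
    using C(1) z(1) by (induction n) (auto simp: convex_cone_iff)
  then have inC: "suminf z \<in> C"
    using closed_sequentially[OF C(2) _ summable_LIMSEQ[OF z(2)]] by blast
  have cv: "convex C" "C \<noteq> {}" using C(1) by (auto simp: convex_cone_def)
  obtain a where a: "\<And>y. y \<in> C \<Longrightarrow> a \<bullet> suminf z \<le> a \<bullet> y"
      "\<And>y. y \<in> rel_interior C \<Longrightarrow> a \<bullet> suminf z < a \<bullet> y"
    using supporting_hyperplane_rel_boundary[OF cv(1) inC notin] by metis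
  have mem: "2 *\<^sub>R suminf z \<in> C" "0 \<in> C" using C(1) inC by (auto simp: convex_cone_iff)
  have 0: "a \<bullet> suminf z = 0" using a(1)[OF mem(1)] a(1)[OF mem(2)] by (simp add: inner_simps)
  then have pos: "0 \<le> a \<bullet> y" if "y \<in> C" for y using a(1)[OF that] by simp
  have "(\<Sum>i. a \<bullet> z i) = 0" using 0 bounded_linear.suminf[OF bounded_linear_inner_right z(2), of a] by simp
  moreover have "summable (\<lambda>i. a \<bullet> z i)" by (rule bounded_linear.summable[OF bounded_linear_inner_right z(2)])
  ultimately have "\<forall>i. a \<bullet> z i = 0" using suminf_eq_zero_iff[of "\<lambda>i. a \<bullet> z i"] pos z(1) by blast
  then have "a \<bullet> y = 0" if "y \<in> C" for y using dense that by blast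
  moreover obtain y where "y \<in> rel_interior C" using cv rel_interior_eq_empty[of C] by blast
  ultimately show False using a(2)[of y] 0 rel_interior_subset[of C] by auto
qed


text \<open>Projecting countably many dense points gives measurable selections that are dense in the
  polar. A convergent positive combination \<open>Z0\<close> of them lies in the relative interior,
  and adding small multiples of \<open>Z0\<close> moves all of them there. Letting the multiples
  shrink recovers the dense family, which determines the cone.\<close>

lemma separating_polar_selections:
  fixes K :: "'a \<Rightarrow> (real ^ 'n) set"
  assumes "solvency_cone_map M K"
  obtains Z :: "nat \<Rightarrow> 'a \<Rightarrow> real ^ 'n" where "\<And>i. Z i \<in> polar_selections M K"
    "\<And>\<omega> w. \<lbrakk>\<omega> \<in> space M; \<forall>i. 0 \<le> Z i \<omega> \<bullet> w\<rbrakk> \<Longrightarrow> w \<in> K \<omega>"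
proof -
  have meas: "measurable_set_map M K" and K: "\<And>\<omega>. \<omega> \<in> space M \<Longrightarrow> closed (K \<omega>)"
    "\<And>\<omega>. \<omega> \<in> space M \<Longrightarrow> convex_cone (K \<omega>)"
    using assms by (auto simp: solvency_cone_map_def)
  have K': "convex (K \<omega>) \<and> closed (K \<omega>) \<and> K \<omega> \<noteq> {}" if "\<omega> \<in> space M" for \<omega>
    using K[OF that] by (auto simp: convex_cone_def)
  obtain D :: "(real ^ 'n) set" where D: "countable D" "\<And>U. open U \<Longrightarrow> U \<noteq> {} \<Longrightarrow> \<exists>d\<in>D. d \<in> U"
    using countable_dense_setE by metis
  have "D \<noteq> {}" using D(2)[of UNIV] by auto
  define q where "q = from_nat_into D"
  have q: "\<exists>i. q i \<in> U" if "open U" "U \<noteq> {}" for U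
    using D(2)[OF that] from_nat_into_surj[OF D(1)] unfolding q_def by metis
  define Y where "Y x \<omega> = closest_point (K \<omega>) x - x" for x \<omega>
  have Y_meas: "Y x \<in> borel_measurable M" for x
    unfolding Y_def by (intro borel_measurable_diff measurable_closest_point[OF meas] K') auto
  have Y_polar: "Y x \<omega> \<in> positive_polar (K \<omega>)" if "\<omega> \<in> space M" for x \<omega>
    unfolding Y_def using K[OF that] by (rule closest_point_diff_in_polar)
  have Y_cont: "continuous_on UNIV (\<lambda>x. Y x \<omega>)" if "\<omega> \<in> space M" for \<omega>
    unfolding Y_def using K'[OF that] by (intro continuous_intros continuous_on_closest_point) auto
  \<comment> \<open>The denominator absorbs the size of the selection: the series is dominated by a
    geometric one, and all weights stay positive.\<close>
  define c where "c i \<omega> = (1 / 2) ^ i / (1 + norm (Y (q i) \<omega>))" for i \<omega>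
  have c: "c i \<omega> > 0" for i \<omega> unfolding c_def by (simp add: add_pos_nonneg)
  define Z0 where "Z0 \<omega> = (\<Sum>i. c i \<omega> *\<^sub>R Y (q i) \<omega>)" for \<omega>
  have Z0_meas: "Z0 \<in> borel_measurable M"
    unfolding Z0_def c_def using Y_meas by measurable
  have Z0: "Z0 \<omega> \<in> rel_interior (positive_polar (K \<omega>))" if \<omega>: "\<omega> \<in> space M" for \<omega>
    unfolding Z0_def
  proof (rule suminf_in_rel_interior)
    show "convex_cone (positive_polar (K \<omega>))" "closed (positive_polar (K \<omega>))"
      by (rule convex_cone_positive_polar closed_positive_polar)+
    show "c i \<omega> *\<^sub>R Y (q i) \<omega> \<in> positive_polar (K \<omega>)" for i
      using Y_polar[OF \<omega>, of "q i"] c[of i \<omega>] convex_cone_positive_polar[of "K \<omega>"]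
      by (auto intro: convex_cone_scaleR less_imp_le)
    show "summable (\<lambda>i. c i \<omega> *\<^sub>R Y (q i) \<omega>)"
    proof (rule summable_comparison_test'[of "\<lambda>i. (1 / 2) ^ i" 0])
      fix i :: nat
      have "norm (Y (q i) \<omega>) / (1 + norm (Y (q i) \<omega>)) \<le> 1"
        by (simp add: divide_le_eq add_pos_nonneg)
      then have "(1 / 2) ^ i * (norm (Y (q i) \<omega>) / (1 + norm (Y (q i) \<omega>))) \<le> (1 / 2) ^ i"
        by (intro mult_left_le) auto
      moreover have "norm (c i \<omega> *\<^sub>R Y (q i) \<omega>) = c i \<omega> * norm (Y (q i) \<omega>)"
        using c[of i \<omega>] by simp
      ultimately show "norm (c i \<omega> *\<^sub>R Y (q i) \<omega>) \<le> (1 / 2) ^ i"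
        by (simp add: c_def)
    qed (simp add: summable_geometric)
    fix a y assume a: "\<And>i. a \<bullet> (c i \<omega> *\<^sub>R Y (q i) \<omega>) = 0" and y: "y \<in> positive_polar (K \<omega>)"
    show "a \<bullet> y = 0"
    proof (rule ccontr)
      assume "a \<bullet> y \<noteq> 0"
      \<comment> \<open>Here \<open>y\<close> equals \<open>Y (- y) \<omega>\<close>; by continuity
        the functional is then nonzero at some dense point as well.\<close>
      then have "- y \<in> {x. a \<bullet> Y x \<omega> \<noteq> 0}"
        using closest_point_uminus_polar[OF K[OF \<omega>] y] by (simp add: Y_def)
      moreover have "open {x. a \<bullet> Y x \<omega> \<noteq> 0}"
        using Y_cont[OF \<omega>] by (intro open_Collect_neq continuous_intros)
      ultimately obtain i where "a \<bullet> Y (q i) \<omega> \<noteq> 0" using q by blast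
      with a[of i] c[of i \<omega>] show False by simp
    qed
  qed
  define Z where "Z n \<omega> = (case prod_decode n of (i, m) \<Rightarrow> Y (q i) \<omega> + inverse (real (Suc m)) *\<^sub>R Z0 \<omega>)" for n \<omega>
  show ?thesis
  proof (rule that[of Z])
    fix n
    show "Z n \<in> polar_selections M K"
      unfolding polar_selections_def
    proof (intro CollectI conjI AE_I2)
      show "Z n \<in> borel_measurable M"
        unfolding Z_def using Y_meas Z0_meas by (cases "prod_decode n") simp
      show "Z n \<omega> \<in> rel_interior (positive_polar (K \<omega>))" if "\<omega> \<in> space M" for \<omega>
        unfolding Z_def using rel_interior_add_convex_cone[OF convex_cone_positive_polar Z0 Y_polar] that
        by (cases "prod_decode n") simp
    qed
  next
    fix \<omega> w assume \<omega>: "\<omega> \<in> space M" and w: "\<forall>n. 0 \<le> Z n \<omega> \<bullet> w"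
    have Yq: "0 \<le> Y (q i) \<omega> \<bullet> w" for i
    proof (rule LIMSEQ_le_const)
      have "(\<lambda>m. (Y (q i) \<omega> + inverse (real (Suc m)) *\<^sub>R Z0 \<omega>) \<bullet> w) \<longlonglongrightarrow> (Y (q i) \<omega> + 0 *\<^sub>R Z0 \<omega>) \<bullet> w"
        by (intro tendsto_intros LIMSEQ_inverse_real_of_nat)
      then show "(\<lambda>m. (Y (q i) \<omega> + inverse (real (Suc m)) *\<^sub>R Z0 \<omega>) \<bullet> w) \<longlonglongrightarrow> Y (q i) \<omega> \<bullet> w" by simp
      show "\<exists>N. \<forall>m\<ge>N. 0 \<le> (Y (q i) \<omega> + inverse (real (Suc m)) *\<^sub>R Z0 \<omega>) \<bullet> w"
        using w[rule_format, of "prod_encode (i, _)"] by (simp add: Z_def)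
    qed
    have "open {x. Y x \<omega> \<bullet> w < 0}"
      using Y_cont[OF \<omega>] by (intro open_Collect_less continuous_intros)
    with q Yq have "{x. Y x \<omega> \<bullet> w < 0} = {}" by (metis mem_Collect_eq not_less)
    \<comment> \<open>The vector is tested against its own residual: by orthogonality
      \<open>Y w \<omega> \<bullet> w\<close> is minus the squared distance of \<open>w\<close> from
      the cone.\<close>
    then have "0 \<le> Y w \<omega> \<bullet> w" using not_less by blast
    moreover have "(w - closest_point (K \<omega>) w) \<bullet> closest_point (K \<omega>) w = 0"
      by (rule closest_point_orthogonal[OF K[OF \<omega>]])
    ultimately have "(w - closest_point (K \<omega>) w) \<bullet> (w - closest_point (K \<omega>) w) \<le> 0"
      using inner_commute[of w "closest_point (K \<omega>) w"]
      unfolding Y_def inner_diff_left inner_diff_right by linarith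
    then have "w = closest_point (K \<omega>) w" by (metis inner_gt_zero_iff not_less right_minus_eq)
    then show "w \<in> K \<omega>" using K'[OF \<omega>] closest_point_in_set by metis
  qed
qed

section \<open>Boundedness of hedging strategies and closedness\<close>

text \<open>Integer bounds turn boundedness into a countable condition, which makes the event of
  unboundedness measurable.\<close>

lemma bounded_range_iff_nat:
  fixes f :: "nat \<Rightarrow> 'b::real_normed_vector"
  shows "bounded (range f) \<longleftrightarrow> (\<exists>N::nat. \<forall>k. norm (f k) \<le> real N)"
proof
  assume "bounded (range f)"
  then obtain b where b: "\<And>k. norm (f k) \<le> b" by (auto simp: bounded_iff)
  obtain N :: nat where "b \<le> real N" using real_arch_simple by blast
  then show "\<exists>N::nat. \<forall>k. norm (f k) \<le> real N" using b by (meson order_trans)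
qed (auto simp: bounded_iff)

text \<open>The factor \<open>l\<close>, which may depend on \<open>Z\<close>, \<open>\<omega>\<close> and \<open>k\<close>, makes the last hypothesis stable under the
  normalization in the induction step.\<close>

lemma asymptotic_bounded:
  fixes x :: "nat \<Rightarrow> 'a \<Rightarrow> real ^ 'd ^ 't::{finite,linorder}"
  assumes filt: "finite_filtration M CARD('t) F"
    and na: "no_arbitrage M F K V"
    and zero: "\<And>Z. Z \<in> polar_selections M K \<Longrightarrow> AE \<omega> in M. V Z \<omega> 0 = 0"
    and x: "\<And>k s. n \<le> date s \<Longrightarrow> (\<lambda>\<omega>. x k \<omega> $ s) \<in> borel_measurable (F (date s))"
    and bdd: "\<And>s. date s < n \<Longrightarrow> AE \<omega> in M. bounded (range (\<lambda>k. x k \<omega> $ s))"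
    and asym: "\<And>Z. Z \<in> polar_selections M K \<Longrightarrow>
      AE \<omega> in M. \<exists>c. \<forall>k. \<exists>l\<ge>1. ereal (- c) \<le> V Z \<omega> (l *\<^sub>R x k \<omega>)"
  shows "AE \<omega> in M. \<forall>s. bounded (range (\<lambda>k. x k \<omega> $ s))"
  using x bdd asym
\<comment> \<open>The induction counts the dates not yet known to be bounded. The sequence is
  generalized because the hypothesis is applied to the normalized sequence and then to the original
  one.\<close>
proof (induction "CARD('t) - n" arbitrary: n x)
  case 0
  then have "date s < n" for s :: 't using date_less_CARD[of s] by simp
  then show ?case using 0 by (simp add: AE_all_countable)
next
  case (Suc m)
  have m: "m = CARD('t) - Suc n" using Suc.hyps(2) by simp
  have space: "space (F (date s)) = space M" for s :: 't
    using filt date_less_CARD[of s] by (auto simp: finite_filtration_def subalgebra_def)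
  have current: "AE \<omega> in M. bounded (range (\<lambda>k. x k \<omega> $ t))" if t: "date t = n" for t
  proof -
    define A where "A = {\<omega>. \<not> bounded (range (\<lambda>k. x k \<omega> $ t))}"
    \<comment> \<open>The index depends only on the component at \<open>t\<close>, so evaluating the
      sequence at it keeps components from date \<open>n\<close> on adapted. The threshold
      \<open>Suc j\<close> makes \<rho> at least 1 and divergent on \<open>A\<close>; off
      \<open>A\<close>, where the threshold may never be reached, \<xi> is zero.\<close>
    define \<tau> where "\<tau> j \<omega> = (LEAST i. real (Suc j) \<le> norm (x i \<omega> $ t))" for j :: nat and \<omega>
    define \<rho> where "\<rho> j \<omega> = norm (x (\<tau> j \<omega>) \<omega> $ t)" for j \<omega>
    define \<xi> where "\<xi> j \<omega> = (if \<omega> \<in> A then inverse (\<rho> j \<omega>) *\<^sub>R x (\<tau> j \<omega>) \<omega> else 0)" for j \<omega>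
    have \<rho>: "real (Suc j) \<le> \<rho> j \<omega>" if "\<omega> \<in> A" for j \<omega>
    proof -
      have "\<exists>i. real (Suc j) \<le> norm (x i \<omega> $ t)"
        using that unfolding A_def bounded_range_iff_nat mem_Collect_eq by (meson less_imp_le not_le)
      then show ?thesis unfolding \<rho>_def \<tau>_def by (rule LeastI_ex)
    qed
    have \<rho>1: "1 \<le> \<rho> j \<omega>" if "\<omega> \<in> A" for j \<omega>
      using \<rho>[OF that, of j] by simp
    \<comment> \<open>At dates before \<open>n\<close> the random index would anticipate; there
      \<open>\<xi>_early\<close> supplies convergence to zero in place of adaptedness.\<close>
    have \<xi>_meas: "(\<lambda>\<omega>. \<xi> j \<omega> $ s) \<in> borel_measurable (F (date s))" if s: "n \<le> date s" for j s
    proof -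
      have "t \<le> s" using s t date_less[of s t] by (auto simp: not_le[symmetric])
      have [measurable]: "(\<lambda>\<omega>. x k \<omega> $ t) \<in> borel_measurable (F (date s))"
        "(\<lambda>\<omega>. x k \<omega> $ s) \<in> borel_measurable (F (date s))" for k
        using borel_measurable_filtration_mono[OF filt \<open>t \<le> s\<close> Suc.prems(1)] Suc.prems(1) s t by auto
      have A: "Measurable.pred (F (date s)) (\<lambda>\<omega>. \<omega> \<in> A)"
        unfolding A_def bounded_range_iff_nat by simp
      have [measurable]: "\<tau> j \<in> measurable (F (date s)) (count_space UNIV)"
        unfolding \<tau>_def by measurable
      have "(\<lambda>\<omega>. x (\<tau> j \<omega>) \<omega> $ t) \<in> borel_measurable (F (date s))"
        "(\<lambda>\<omega>. x (\<tau> j \<omega>) \<omega> $ s) \<in> borel_measurable (F (date s))"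
        by (rule measurable_compose_countable[where g="\<tau> j"]; measurable)+
      then have "(\<lambda>\<omega>. if \<omega> \<in> A then inverse (\<rho> j \<omega>) *\<^sub>R x (\<tau> j \<omega>) \<omega> $ s else 0)
          \<in> borel_measurable (F (date s))"
        unfolding \<rho>_def using A by measurable
      also have "(\<lambda>\<omega>. if \<omega> \<in> A then inverse (\<rho> j \<omega>) *\<^sub>R x (\<tau> j \<omega>) \<omega> $ s else 0) = (\<lambda>\<omega>. \<xi> j \<omega> $ s)"
        by (auto simp: \<xi>_def)
      finally show ?thesis .
    qed
    have \<xi>_early: "(\<lambda>j. \<xi> j \<omega> $ s) \<longlonglongrightarrow> 0" if "bounded (range (\<lambda>k. x k \<omega> $ s))" for \<omega> s
    proof (cases "\<omega> \<in> A")
      case True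
      obtain b where b: "\<And>k. norm (x k \<omega> $ s) \<le> b" using \<open>bounded _\<close> by (auto simp: bounded_iff)
      have "norm (\<xi> j \<omega> $ s) \<le> inverse (real (Suc j)) * b" for j
      proof -
        have "inverse (\<rho> j \<omega>) \<le> inverse (real (Suc j))"
          using \<rho>[OF True, of j] by (intro le_imp_inverse_le) auto
        then have "inverse (\<rho> j \<omega>) * norm (x (\<tau> j \<omega>) \<omega> $ s) \<le> inverse (real (Suc j)) * b"
          by (rule mult_mono) (simp_all add: b)
        then show ?thesis
          using True \<rho>1[OF True, of j] by (simp add: \<xi>_def)
      qed
      moreover have "(\<lambda>j. inverse (real (Suc j)) * b) \<longlonglongrightarrow> 0"
        by (rule tendsto_mult_left_zero[OF LIMSEQ_inverse_real_of_nat])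
      ultimately show ?thesis by (rule Lim_null_comparison[OF always_eventually[OF allI]])
    qed (simp add: \<xi>_def)
    have \<xi>_norm: "norm (\<xi> j \<omega> $ t) = 1" if "\<omega> \<in> A" for j \<omega>
    proof -
      have "\<rho> j \<omega> > 0" using \<rho>1[OF that, of j] by simp
      then show ?thesis using that by (simp add: \<xi>_def flip: \<rho>_def)
    qed
    have \<xi>_bdd: "AE \<omega> in M. \<forall>s. bounded (range (\<lambda>j. \<xi> j \<omega> $ s))"
    proof (rule Suc.hyps(1)[OF m])
      show "(\<lambda>\<omega>. \<xi> k \<omega> $ s) \<in> borel_measurable (F (date s))" if "Suc n \<le> date s" for k s
        using \<xi>_meas that by simp
      show "AE \<omega> in M. bounded (range (\<lambda>k. \<xi> k \<omega> $ s))" if s: "date s < Suc n" for s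
      proof (cases "s = t")
        case True
        have "norm (\<xi> j \<omega> $ t) \<le> 1" for j \<omega> using \<xi>_norm by (cases "\<omega> \<in> A") (auto simp: \<xi>_def)
        then show ?thesis using True by (auto simp: bounded_iff)
      next
        case False
        then have "date s < n" using s t date_eq_iff[of s t] by simp
        from Suc.prems(2)[OF this] show ?thesis
          using \<xi>_early by (auto elim!: eventually_mono intro: convergent_imp_bounded)
      qed
      fix Z assume Z: "Z \<in> polar_selections M K"
      show "AE \<omega> in M. \<exists>c. \<forall>k. \<exists>l\<ge>1. ereal (- c) \<le> V Z \<omega> (l *\<^sub>R \<xi> k \<omega>)"
        using Suc.prems(3)[OF Z] zero[OF Z]
      proof eventually_elim
        case (elim \<omega>)
        show ?case
        proof (cases "\<omega> \<in> A")
          case True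
          obtain c where c: "\<And>k. \<exists>l\<ge>1. ereal (- c) \<le> V Z \<omega> (l *\<^sub>R x k \<omega>)" using elim(1) by blast
          have "\<exists>l\<ge>1. ereal (- c) \<le> V Z \<omega> (l *\<^sub>R \<xi> j \<omega>)" for j
          proof -
            obtain l where l: "l \<ge> 1" "ereal (- c) \<le> V Z \<omega> (l *\<^sub>R x (\<tau> j \<omega>) \<omega>)" using c by blast
            \<comment> \<open>The factor \<open>l * \<rho> j \<omega>\<close> undoes the
              normalization, so the same \<open>c\<close> works for \<xi>.\<close>
            have "1 \<le> l * \<rho> j \<omega>" using l(1) \<rho>1[OF True, of j] mult_mono[of 1 l 1 "\<rho> j \<omega>"] by simp
            moreover have "(l * \<rho> j \<omega>) *\<^sub>R \<xi> j \<omega> = l *\<^sub>R x (\<tau> j \<omega>) \<omega>"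
              using True \<rho>1[OF True, of j] by (simp add: \<xi>_def)
            ultimately show ?thesis using l(2) by metis
          qed
          then show ?thesis by blast
        next
          case False
          then show ?thesis using elim(2) by (intro exI[of _ 0]) (auto simp: \<xi>_def)
        qed
      qed
    qed
    obtain y where y: "y \<in> strategies F" and y0: "\<And>\<omega> s. \<not> n \<le> date s \<Longrightarrow> y \<omega> $ s = 0"
      and cluster: "\<And>\<omega> e. \<lbrakk>\<And>s. n \<le> date s \<Longrightarrow> bounded (range (\<lambda>k. \<xi> k \<omega> $ s)); e > 0\<rbrakk>
       \<Longrightarrow> \<exists>\<^sub>F k in sequentially. \<forall>s\<in>{s. n \<le> date s}. norm (\<xi> k \<omega> $ s - y \<omega> $ s) < e"
      using adapted_cluster[OF filt, where S="{s. n \<le> date s}" and x=\<xi>] \<xi>_meas by auto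
    have early: "AE \<omega> in M. \<forall>s\<in>{s. date s < n}. bounded (range (\<lambda>k. x k \<omega> $ s))"
      using Suc.prems(2) by (intro AE_finite_allI) auto
    have "AE \<omega> in M. 0 \<le> horizon (V Z \<omega>) (y \<omega>)" if Z: "Z \<in> polar_selections M K" for Z
      using Suc.prems(3)[OF Z] zero[OF Z] \<xi>_bdd early
    proof eventually_elim
      case (elim \<omega>)
      obtain r where r: "strict_mono r" "(\<lambda>j. \<xi> (r j) \<omega>) \<longlonglongrightarrow> y \<omega>"
      proof (rule vec_cluster_subseq[of "{s. n \<le> date s}" "\<lambda>k. \<xi> k \<omega>" "y \<omega>"])
        show "\<exists>\<^sub>F k in sequentially. \<forall>s\<in>{s. n \<le> date s}. norm (\<xi> k \<omega> $ s - y \<omega> $ s) < e" if "e > 0" for e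
          using elim(3) that by (intro cluster) auto
        show "(\<lambda>k. \<xi> k \<omega> $ s) \<longlonglongrightarrow> y \<omega> $ s" if "s \<notin> {s. n \<le> date s}" for s
          using that elim(4) \<xi>_early y0 by simp
      qed blast
      show ?case
      proof (cases "\<omega> \<in> A")
        case True
        obtain c where "\<forall>k. \<exists>l\<ge>1. ereal (- c) \<le> V Z \<omega> (l *\<^sub>R x k \<omega>)" using elim(1) by blast
        then obtain l where l: "\<And>k. l k \<ge> 1" "\<And>k. ereal (- c) \<le> V Z \<omega> (l k *\<^sub>R x k \<omega>)" by metis
        define i where "i j = \<tau> (r j) \<omega>" for j
        \<comment> \<open>This factor takes the points
          \<open>l (i j) *\<^sub>R x (i j) \<omega>\<close>, at which \<open>V Z \<omega>\<close> is
          bounded below, to \<open>\<xi> (r j) \<omega>\<close>. It tends to zero because \<rho>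
          diverges and \<open>r j\<close> is at least \<open>j\<close>.\<close>
        define a where "a j = inverse (l (i j) * \<rho> (r j) \<omega>)" for j
        have ge: "real (Suc j) \<le> l (i j) * \<rho> (r j) \<omega>" for j
        proof -
          have "real (Suc j) \<le> real (Suc (r j))" using seq_suble[OF r(1), of j] by simp
          also have "\<dots> \<le> \<rho> (r j) \<omega>" by (rule \<rho>[OF True])
          also have "\<dots> \<le> l (i j) * \<rho> (r j) \<omega>"
            using mult_right_mono[OF l(1), of "\<rho> (r j) \<omega>" "i j"] \<rho>1[OF True, of "r j"] by simp
          finally show ?thesis .
        qed
        show ?thesis
        proof (rule horizon_nonneg)
          show pos: "a j > 0" for j
            using ge[of j] unfolding a_def by (intro positive_imp_inverse_positive) (simp add: less_le_trans)
          have "norm (a j) \<le> inverse (real (Suc j))" for j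
            using le_imp_inverse_le[OF ge[of j]] pos[of j] by (simp add: a_def)
          then show "a \<longlonglongrightarrow> 0"
            by (rule Lim_null_comparison[OF always_eventually[OF allI] LIMSEQ_inverse_real_of_nat])
          have "a j *\<^sub>R (l (i j) *\<^sub>R x (i j) \<omega>) = \<xi> (r j) \<omega>" for j
            using True l(1)[of "i j"] by (simp add: a_def \<xi>_def i_def)
          then show "(\<lambda>j. a j *\<^sub>R (l (i j) *\<^sub>R x (i j) \<omega>)) \<longlonglongrightarrow> y \<omega>" using r(2) by simp
          show "ereal (- c) \<le> V Z \<omega> (l (i j) *\<^sub>R x (i j) \<omega>)" for j by (rule l(2))
        qed
      next
        case False
        \<comment> \<open>Off \<open>A\<close> the limit is zero, and the constant sequence 0 with
          \<open>V Z \<omega> 0 = 0\<close> witnesses nonnegativity.\<close>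
        then have "y \<omega> = 0" using r(2) by (simp add: \<xi>_def LIMSEQ_const_iff)
        then show ?thesis
          using elim(2) by (intro horizon_nonneg[of "\<lambda>k. inverse (real (Suc k))" "\<lambda>_. 0" _ 0])
            (auto intro: LIMSEQ_inverse_real_of_nat simp del: of_nat_Suc)
      qed
    qed
    then have "AE \<omega> in M. y \<omega> = 0" using na y unfolding no_arbitrage_def by blast
    with \<xi>_bdd show ?thesis
    proof eventually_elim
      case (elim \<omega>)
      \<comment> \<open>On \<open>A\<close> the component of \<xi> at \<open>t\<close> has norm one,
        yet it would have to come within distance less than 1 of zero.\<close>
      have "\<exists>\<^sub>F k in sequentially. \<forall>s\<in>{s. n \<le> date s}. norm (\<xi> k \<omega> $ s - y \<omega> $ s) < 1"
        using elim(1) by (intro cluster) auto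
      then obtain k where "norm (\<xi> k \<omega> $ t) < 1" using elim(2) t by (auto dest!: frequently_ex)
      then have "\<omega> \<notin> A" using \<xi>_norm[of \<omega> k] by auto
      then show ?case by (simp add: A_def)
    qed
  qed
  \<comment> \<open>With date \<open>n\<close> settled, the induction hypothesis applies to the
    original sequence.\<close>
  show ?case
  proof (rule Suc.hyps(1)[OF m])
    show "AE \<omega> in M. bounded (range (\<lambda>k. x k \<omega> $ s))" if "date s < Suc n" for s
      using that current[of s] Suc.prems(2)[of s] by (auto simp: less_Suc_eq)
  qed (use Suc.prems in auto)
qed

section \<open>Passage to the limit in the superhedging inequality\<close>

theorem theorem5p11:
  fixes M :: "'a measure"
    and F :: "nat \<Rightarrow> 'a measure"
    and K :: "'a \<Rightarrow> (real ^ 'n) set"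
    and Vh :: "('a \<Rightarrow> real ^ 'd ^ 't::{finite,linorder}) \<Rightarrow> 'a \<Rightarrow> (real ^ 'n) option"
    and V :: "('a \<Rightarrow> real ^ 'n) \<Rightarrow> 'a \<Rightarrow> real ^ 'd ^ 't::{finite,linorder} \<Rightarrow> ereal"
  assumes "prob_space M"
    and "finite_filtration M CARD('t) F"
    and "solvency_cone_map M K"
    and "market_model M F Vh"
    and "usc_market M F K Vh"
    and "\<And>Z. Z \<in> polar_selections M K \<Longrightarrow>
           represents M F (V Z) (\<lambda>\<theta> \<omega>. ext_inner (Z \<omega>) (Vh \<theta> \<omega>))"
    and "no_arbitrage M F K V"
  shows "closed_in_probability M (superhedgeable M F K Vh)"
  unfolding closed_in_probability_def
proof (intro allI ballI impI, elim conjE)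
  fix X Y
  assume Y: "Y \<in> borel_measurable M" and X: "\<forall>k. X k \<in> superhedgeable M F K Vh"
    and lim: "tendsto_in_probability M X Y"
  have rep: "AE \<omega> in M. ext_inner (Z \<omega>) (Vh \<theta> \<omega>) = V Z \<omega> (\<theta> \<omega>)"
    if "Z \<in> polar_selections M K" "\<theta> \<in> strategies F" for Z \<theta>
    using assms(6)[OF that(1)] that(2) by (auto simp: represents_def)
  have "X k \<in> borel_measurable M" for k using X by (simp add: superhedgeable_def)
  from AE_subseq_of_tendsto_in_probability[OF assms(1) lim this Y]
  obtain r where r: "strict_mono r" and conv: "AE \<omega> in M. (\<lambda>k. X (r k) \<omega>) \<longlonglongrightarrow> Y \<omega>" by metis
  define h where "h k = X (r k)" for k
  have "\<forall>k. \<exists>\<theta>\<in>strategies F. AE \<omega> in M. cone_ge (K \<omega>) (Vh \<theta> \<omega>) (Some (h k \<omega>))"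
    using X by (auto simp: superhedgeable_def h_def)
  then obtain \<theta> where \<theta>: "\<And>k. \<theta> k \<in> strategies F"
    and hedge: "\<And>k. AE \<omega> in M. cone_ge (K \<omega>) (Vh (\<theta> k) \<omega>) (Some (h k \<omega>))" by metis
  \<comment> \<open>Dominating a finite claim excludes the value minus infinity, and pairing the
    surplus in the cone with a polar vector gives a scalar inequality.\<close>
  have low: "AE \<omega> in M. \<forall>k. ereal (Z \<omega> \<bullet> h k \<omega>) \<le> V Z \<omega> (\<theta> k \<omega>)"
    if Z: "Z \<in> polar_selections M K" for Z
    unfolding AE_all_countable
  proof
    fix k
    have "AE \<omega> in M. Z \<omega> \<in> rel_interior (positive_polar (K \<omega>))" using Z by (simp add: polar_selections_def)
    with hedge[of k] rep[OF Z \<theta>, of k] show "AE \<omega> in M. ereal (Z \<omega> \<bullet> h k \<omega>) \<le> V Z \<omega> (\<theta> k \<omega>)"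
    proof eventually_elim
      case (elim \<omega>)
      then obtain v where v: "Vh (\<theta> k) \<omega> = Some v" "v - h k \<omega> \<in> K \<omega>" by (cases "Vh (\<theta> k) \<omega>") auto
      have "Z \<omega> \<in> positive_polar (K \<omega>)" using elim(3) rel_interior_subset by blast
      then have "0 \<le> (v - h k \<omega>) \<bullet> Z \<omega>" using v(2) by (simp add: positive_polar_def)
      then have "Z \<omega> \<bullet> h k \<omega> \<le> Z \<omega> \<bullet> v" by (simp add: inner_simps inner_commute)
      then show ?case using elim(2) v(1) by (metis ereal_less_eq(3) ext_inner.simps(2))
    qed
  qed
  have zero: "AE \<omega> in M. V Z \<omega> 0 = 0" if Z: "Z \<in> polar_selections M K" for Z
  proof -
    have "(\<lambda>_. 0) \<in> strategies F" by (simp add: strategies_def)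
    from rep[OF Z this] have "AE \<omega> in M. ext_inner (Z \<omega>) (Vh (\<lambda>_. 0) \<omega>) = V Z \<omega> 0" .
    moreover have "AE \<omega> in M. Vh (\<lambda>_. 0) \<omega> = Some 0" using assms(4) by (simp add: market_model_def)
    ultimately show ?thesis by eventually_elim (simp add: zero_ereal_def)
  qed
  \<comment> \<open>The start is \<open>n = 0\<close>, with no earlier dates to bound, and factor 1;
    the constant \<open>c\<close> bounds the convergent scalarized claims.\<close>
  have bdd: "AE \<omega> in M. \<forall>s. bounded (range (\<lambda>k. \<theta> k \<omega> $ s))"
  proof (rule asymptotic_bounded[OF assms(2,7) zero, of 0])
    show "(\<lambda>\<omega>. \<theta> k \<omega> $ s) \<in> borel_measurable (F (date s))" for k s
      using \<theta>[of k] by (simp add: strategies_def)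
    fix Z assume Z: "Z \<in> polar_selections M K"
    show "AE \<omega> in M. \<exists>c. \<forall>k. \<exists>l\<ge>1. ereal (- c) \<le> V Z \<omega> (l *\<^sub>R \<theta> k \<omega>)"
      using low[OF Z] conv
    proof eventually_elim
      case (elim \<omega>)
      have "(\<lambda>k. Z \<omega> \<bullet> h k \<omega>) \<longlonglongrightarrow> Z \<omega> \<bullet> Y \<omega>" unfolding h_def by (intro tendsto_intros elim(2))
      then have "bounded (range (\<lambda>k. Z \<omega> \<bullet> h k \<omega>))" by (rule convergent_imp_bounded)
      then obtain c where c: "\<And>k. \<bar>Z \<omega> \<bullet> h k \<omega>\<bar> \<le> c" by (auto simp: bounded_iff)
      have "ereal (- c) \<le> V Z \<omega> (1 *\<^sub>R \<theta> k \<omega>)" for k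
      proof -
        have "- c \<le> Z \<omega> \<bullet> h k \<omega>" using c[of k] by linarith
        then have "ereal (- c) \<le> ereal (Z \<omega> \<bullet> h k \<omega>)" by simp
        also have "\<dots> \<le> V Z \<omega> (\<theta> k \<omega>)" using elim(1) by blast
        finally show ?thesis by simp
      qed
      then show ?case by (intro exI[of _ c] allI exI[of _ 1]) simp
    qed
  qed simp_all
  obtain \<eta> where \<eta>: "\<eta> \<in> strategies F"
    and cluster: "\<And>\<omega> e. \<lbrakk>\<And>s. bounded (range (\<lambda>k. \<theta> k \<omega> $ s)); e > 0\<rbrakk>
       \<Longrightarrow> \<exists>\<^sub>F k in sequentially. \<forall>s\<in>UNIV. norm (\<theta> k \<omega> $ s - \<eta> \<omega> $ s) < e"
    using adapted_cluster[OF assms(2), where S=UNIV and x=\<theta>] \<theta> by (auto simp: strategies_def)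
  have limit: "AE \<omega> in M. ereal (Z \<omega> \<bullet> Y \<omega>) \<le> ext_inner (Z \<omega>) (Vh \<eta> \<omega>)"
    if Z: "Z \<in> polar_selections M K" for Z
    using low[OF Z] conv bdd rep[OF Z \<eta>] AE_space
  proof eventually_elim
    case (elim \<omega>)
    \<comment> \<open>The subsequence varies with \<omega>, but the claims converge along any of
      them, so the pairs of strategy and scalarized claim converge inside the closed
      hypograph.\<close>
    obtain q where q: "strict_mono q" "(\<lambda>j. \<theta> (q j) \<omega>) \<longlonglongrightarrow> \<eta> \<omega>"
      by (rule vec_cluster_subseq[of UNIV "\<lambda>k. \<theta> k \<omega>" "\<eta> \<omega>"]) (use cluster elim(3) in auto)
    have "closed {(x, c::real). ereal c \<le> V Z \<omega> x}"
      using assms(6)[OF Z] elim(5) by (auto simp: represents_def normal_integrand_def)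
    moreover have "(\<theta> (q j) \<omega>, Z \<omega> \<bullet> h (q j) \<omega>) \<in> {(x, c). ereal c \<le> V Z \<omega> x}" for j
      using elim(1) by simp
    moreover have "(\<lambda>j. (\<theta> (q j) \<omega>, Z \<omega> \<bullet> h (q j) \<omega>)) \<longlonglongrightarrow> (\<eta> \<omega>, Z \<omega> \<bullet> Y \<omega>)"
      using LIMSEQ_subseq_LIMSEQ[OF elim(2) q(1)] unfolding h_def o_def
      by (intro tendsto_intros q(2))
    ultimately have "(\<eta> \<omega>, Z \<omega> \<bullet> Y \<omega>) \<in> {(x, c). ereal c \<le> V Z \<omega> x}"
      by (rule closed_sequentially)
    then show ?case using elim(4) by simp
  qed
  \<comment> \<open>The exceptional null set in \<open>limit\<close> depends on the selection; a
    countable separating family leaves a single null set.\<close>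
  obtain Z :: "nat \<Rightarrow> 'a \<Rightarrow> real ^ 'n" where Z: "\<And>i. Z i \<in> polar_selections M K"
    and sep: "\<And>\<omega> w. \<lbrakk>\<omega> \<in> space M; \<forall>i. 0 \<le> Z i \<omega> \<bullet> w\<rbrakk> \<Longrightarrow> w \<in> K \<omega>"
    using separating_polar_selections[OF assms(3)] by blast
  have "AE \<omega> in M. \<forall>i. ereal (Z i \<omega> \<bullet> Y \<omega>) \<le> ext_inner (Z i \<omega>) (Vh \<eta> \<omega>)"
    unfolding AE_all_countable using limit Z by blast
  then have "AE \<omega> in M. cone_ge (K \<omega>) (Vh \<eta> \<omega>) (Some (Y \<omega>))"
    using AE_space
  proof eventually_elim
    case (elim \<omega>)
    \<comment> \<open>One inequality with a finite left side already rules out minus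
      infinity.\<close>
    then obtain v where v: "Vh \<eta> \<omega> = Some v" by (cases "Vh \<eta> \<omega>") auto
    have "v - Y \<omega> \<in> K \<omega>"
      using elim v by (intro sep) (auto simp: inner_simps)
    then show ?case using v by simp
  qed
  then show "Y \<in> superhedgeable M F K Vh" using Y \<eta> by (auto simp: superhedgeable_def)
qed

end
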